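(* Let $p$ be a prime and $d$ an integer with $d\mid p-1$, $1<d<p-1$ and $d\notin\{2,6\}$. Then there is no set $A\subseteq\mathbb F_p$ such that the pair $(A,-A)$ is $d$-critical, except possibly when $p=41$ and $d=20$.
   Context: $\mu_d$ denotes the set of $d$-th roots of unity in $\mathbb F_p$. A pair $(A,B)$ of subsets of $\mathbb F_p$ with $|A|,|B|>1$ is called $d$-critical if $A+B=\{a+b:a\in A,b\in B\}\subseteq\mu_d\cup\{0\}$ and $|A||B|=d+|(-A)\cap B|$, where $-A=\{-a:a\in A\}$. *)

theory Defs
  imports "Berlekamp_Zassenhaus.Finite_Field"
begin

text \<open>
  The prime field with \<open>p\<close> elements is the type \<open>'p mod_ring\<close> with \<open>'p :: prime_card\<close>,
  where \<open>p = CARD('p)\<close>; the class \<open>prime_card\<close> says exactly that this number is prime.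
\<close>

definition roots_unity :: "nat \<Rightarrow> 'p::prime_card mod_ring set" where
  "roots_unity d = {x. x ^ d = 1}"

definition d_critical ::
    "nat \<Rightarrow> 'p::prime_card mod_ring set \<Rightarrow> 'p mod_ring set \<Rightarrow> bool" where
  "d_critical d A B \<longleftrightarrow>
     card A > 1 \<and> card B > 1 \<and>
     {a + b | a b. a \<in> A \<and> b \<in> B} \<subseteq> roots_unity d \<union> {0} \<and>
     card A * card B = d + card (uminus ` A \<inter> B)"

end

theory Submission
  imports Defs "HOL-Computational_Algebra.Polynomial_FPS"
begin

text \<open>
  Let \<open>n = |A|\<close>, so that \<open>d = n (n - 1)\<close>, and let \<open>P\<close> be the monic polynomial with root set \<open>A\<close>.
  The equality case of the Hanson--Petridis (Stepanov) argument is the identity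
  \<open>\<Sum>\<^sub>a (x - a)^(n\<^sup>2 - 1) / P'(a) = (-1)^(n - 1) (1 + binom(n\<^sup>2 - 1, n - 1) P^(n - 1))\<close>.
  Around a root \<open>a\<close> put \<open>t = x - a\<close> and \<open>P = P'(a) t f\<close>. By the partial fractions of \<open>1 / P\<close> the left
  side has the coefficients of \<open>1 / f\<close>, up to binomial factors, and the right side those of \<open>f^(n - 1)\<close>.
  Hence \<open>f\<close> agrees with \<open>(1 - s t)^n\<close> modulo \<open>t\<^sup>4\<close> for some \<open>s\<close>, and the fourth transvectant with itself
  of \<open>P\<close>, viewed as a binary form of degree \<open>n + 1\<close> with an additional root at infinity, is divisible by
  \<open>P\<^sup>2\<close>; so it vanishes for degree reasons. As in the classification of the forms with this property (the
  vertices of the tetrahedron, octahedron and icosahedron), comparing the two highest terms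
  \<open>x^n + c x^(n - j)\<close> of a centred \<open>P\<close> leaves only \<open>(n, j) = (5, 4)\<close> and \<open>(11, 5)\<close>.
  In these two cases the coefficient of \<open>x^(d - j)\<close> in the identity restricts \<open>p\<close> to the prime
  divisors of an explicit integer.
\<close>

section \<open>Coefficients of products, powers and inverses\<close>

lemma coeff_mult_degree_le:
  fixes p q :: "'a::comm_semiring_0 poly"
  assumes "degree p \<le> m" "degree q \<le> n"
  shows "coeff (p * q) (m + n) = coeff p m * coeff q n"
proof (cases "degree p = m \<and> degree q = n")
  case True
  then show ?thesis using coeff_mult_degree_sum[of p q] by simp
next
  case False
  then have "degree p < m \<or> degree q < n" using assms by auto
  then show ?thesis
    using degree_mult_le[of p q] assms by (auto simp: coeff_eq_0)
qed

lemma coeff_power_degree_le: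
  fixes p :: "'a::comm_semiring_1 poly"
  assumes "degree p \<le> n"
  shows "coeff (p ^ k) (n * k) = coeff p n ^ k"
proof (induction k)
  case (Suc k)
  have "degree (p ^ k) \<le> n * k"
    using degree_power_le[of p k] assms by (meson le_trans mult_le_mono1)
  then show ?case
    using coeff_mult_degree_le[OF assms, of "p ^ k" "n * k"] Suc by simp
qed simp

lemma coeff_power_monom_plus:
  fixes R :: "'a::comm_ring_1 poly"
  assumes "degree R \<le> m" "m < n"
  shows "coeff ((monom 1 n + R) ^ Suc k) (n * k + m) = of_nat (Suc k) * coeff R m"
proof (induction k)
  case 0
  then show ?case using assms(2) by simp
next
  case (Suc k)
  let ?p = "monom 1 n + R"
  have deg: "degree ?p \<le> n" using assms by (intro degree_add_le degree_monom_le) auto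
  then have "degree (?p ^ Suc k) \<le> n * Suc k"
    using degree_power_le[of ?p "Suc k"] by (meson le_trans mult_le_mono1)
  moreover have "coeff (?p ^ Suc k) (n * Suc k) = 1"
    using coeff_power_degree_le[OF deg, of "Suc k"] assms by (simp add: coeff_eq_0)
  ultimately have "coeff (?p ^ Suc k * R) (n * Suc k + m) = coeff R m"
    using coeff_mult_degree_le[of "?p ^ Suc k" "n * Suc k" R m] assms(1) by simp
  moreover have "?p ^ Suc (Suc k) = monom 1 n * ?p ^ Suc k + ?p ^ Suc k * R"
    by (simp add: algebra_simps)
  then have "coeff (?p ^ Suc (Suc k)) (n * Suc k + m)
      = coeff (?p ^ Suc k) (n * k + m) + coeff (?p ^ Suc k * R) (n * Suc k + m)"
    by (simp only: coeff_add coeff_monom_mult) (simp add: algebra_simps)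
  ultimately show ?case using Suc by (simp add: algebra_simps)
qed

lemma coeff_mult_two_top_terms:
  fixes p q :: "'a::comm_semiring_0 poly"
  assumes "m < n" "\<And>i. m < i \<Longrightarrow> i \<noteq> n \<Longrightarrow> coeff p i = 0"
    and "\<And>i. m < i \<Longrightarrow> i \<noteq> n \<Longrightarrow> coeff q i = 0"
  shows "coeff (p * q) (n + m) = coeff p n * coeff q m + coeff p m * coeff q n"
proof -
  have "coeff (p * q) (n + m) = (\<Sum>i\<in>{m, n}. coeff p i * coeff q (n + m - i))"
    unfolding coeff_mult
  proof (intro sum.mono_neutral_right ballI)
    fix i assume i: "i \<in> {..n + m} - {m, n}"
    show "coeff p i * coeff q (n + m - i) = 0"
      using i assms(1) assms(2)[of i] assms(3)[of "n + m - i"] by (cases "m < i") auto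
  qed auto
  then show ?thesis using assms(1) by (simp add: add.commute)
qed

lemma coeff_monom_mult_higher_pderiv:
  fixes p :: "'a::idom poly"
  shows "coeff (monom 1 k * (pderiv ^^ k) p) i = (\<Prod>l<k. of_nat i - of_nat l) * coeff p i"
proof (cases "i < k")
  case True
  then have "(\<Prod>l<k. of_nat i - of_nat l :: 'a) = 0" by (intro prod_zero) auto
  then show ?thesis using True by (simp add: coeff_monom_mult)
next
  case False
  have "pochhammer (of_nat (Suc (i - k))) k = (\<Prod>l<k. of_nat i - of_nat l :: 'a)"
    unfolding pochhammer_prod using False
    by (intro prod.reindex_bij_witness[of _ "\<lambda>l. k - 1 - l" "\<lambda>l. k - 1 - l"])
      (auto simp: of_nat_diff algebra_simps)
  then show ?thesis using False by (simp add: coeff_monom_mult coeff_higher_pderiv)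
qed

lemma degree_higher_pderiv_le: "degree ((pderiv ^^ k) p) \<le> degree p - k"
  for p :: "'a::idom poly"
proof (induction k)
  case (Suc k)
  then show ?case using degree_pderiv_le[of "(pderiv ^^ k) p"] by simp
qed simp

lemma higher_pderiv_pcompose_shift:
  "(pderiv ^^ k) (pcompose p [:c, 1:]) = pcompose ((pderiv ^^ k) p) [:c, 1:]"
  for p :: "'a::idom poly"
  by (induction k) (simp_all add: pderiv_pcompose pderiv_pCons)

lemma linear_power_dvd_iff_coeff_pcompose:
  fixes f :: "'a::idom poly"
  shows "[:-a, 1:] ^ k dvd f \<longleftrightarrow> (\<forall>i<k. coeff (pcompose f [:a, 1:]) i = 0)"
proof -
  have shift: "pcompose (pcompose f [:a, 1:]) [:-a, 1:] = f"
    by (simp add: pcompose_assoc[symmetric])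
  have "[:-a, 1:] ^ k dvd f \<longleftrightarrow> monom 1 k dvd pcompose f [:a, 1:]"
  proof
    assume "[:-a, 1:] ^ k dvd f"
    then obtain g where "f = [:-a, 1:] ^ k * g" by (elim dvdE)
    then have "pcompose f [:a, 1:] = monom 1 k * pcompose g [:a, 1:]"
      by (simp add: pcompose_mult pcompose_hom.hom_power monom_altdef)
    then show "monom 1 k dvd pcompose f [:a, 1:]" by simp
  next
    assume "monom 1 k dvd pcompose f [:a, 1:]"
    then obtain g where "pcompose f [:a, 1:] = monom 1 k * g" by (elim dvdE)
    then have "f = [:-a, 1:] ^ k * pcompose g [:-a, 1:]"
      using shift by (simp add: pcompose_mult pcompose_hom.hom_power monom_altdef)
    then show "[:-a, 1:] ^ k dvd f" by simp
  qed
  then show ?thesis by (simp add: monom_1_dvd_iff')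
qed

lemma fps_power_second:
  fixes f :: "'a::comm_ring_1 fps"
  assumes "fps_nth f 0 = 1"
  shows "2 * fps_nth (f ^ k) 2
    = of_nat k * (2 * fps_nth f 2 + (of_nat k - 1) * (fps_nth f 1)\<^sup>2)"
proof (induction k)
  case (Suc k)
  have "2 * fps_nth (f ^ Suc k) 2
      = 2 * fps_nth (f ^ k) 2 + 2 * fps_nth f 1 * fps_nth (f ^ k) 1 + 2 * fps_nth f 2"
    by (simp add: fps_mult_nth assms fps_power_zeroth_eq_one eval_nat_numeral algebra_simps)
  then show ?case
    unfolding Suc fps_power_first_eq[OF assms] by (simp add: power2_eq_square algebra_simps)
qed simp

lemma fps_power_third:
  fixes f :: "'a::comm_ring_1 fps"
  assumes "fps_nth f 0 = 1"
  shows "6 * fps_nth (f ^ k) 3 = of_nat k * (6 * fps_nth f 3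
      + 6 * (of_nat k - 1) * fps_nth f 1 * fps_nth f 2
      + (of_nat k - 1) * (of_nat k - 2) * (fps_nth f 1) ^ 3)"
proof (induction k)
  case (Suc k)
  have "6 * fps_nth (f ^ Suc k) 3 = 6 * fps_nth (f ^ k) 3
      + 3 * fps_nth f 1 * (2 * fps_nth (f ^ k) 2) + 6 * fps_nth f 2 * fps_nth (f ^ k) 1
      + 6 * fps_nth f 3"
    by (simp add: fps_mult_nth assms fps_power_zeroth_eq_one eval_nat_numeral algebra_simps)
  then show ?case
    unfolding Suc fps_power_first_eq[OF assms] fps_power_second[OF assms]
    by (simp add: power2_eq_square power3_eq_cube algebra_simps)
qed simp

lemma fps_inverse_second_third:
  fixes f :: "'a::field fps"
  assumes "fps_nth f 0 = 1"
  shows "fps_nth (inverse f) 2 = (fps_nth f 1)\<^sup>2 - fps_nth f 2"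
    and "fps_nth (inverse f) 3 = 2 * fps_nth f 1 * fps_nth f 2 - fps_nth f 3 - (fps_nth f 1) ^ 3"
proof -
  have inv: "fps_nth (f * inverse f) k = fps_nth 1 k" for k
    using assms by (simp add: inverse_mult_eq_1')
  have zeroth: "fps_nth (inverse f) 0 = 1" using assms by simp
  have first: "fps_nth (inverse f) 1 = - fps_nth f 1"
    using inv[of 1] zeroth assms by (simp add: fps_mult_nth eq_neg_iff_add_eq_0)
  have "fps_nth (inverse f) 2 + fps_nth f 1 * fps_nth (inverse f) 1 + fps_nth f 2 = 0"
    using inv[of 2] zeroth assms by (simp add: fps_mult_nth eval_nat_numeral algebra_simps)
  then show second: "fps_nth (inverse f) 2 = (fps_nth f 1)\<^sup>2 - fps_nth f 2"
    unfolding first by (simp add: power2_eq_square algebra_simps)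
  have "fps_nth (inverse f) 3 + fps_nth f 1 * fps_nth (inverse f) 2
      + fps_nth f 2 * fps_nth (inverse f) 1 + fps_nth f 3 = 0"
    using inv[of 3] zeroth assms by (simp add: fps_mult_nth eval_nat_numeral algebra_simps)
  then show "fps_nth (inverse f) 3
      = 2 * fps_nth f 1 * fps_nth f 2 - fps_nth f 3 - (fps_nth f 1) ^ 3"
    unfolding first second by (simp add: power2_eq_square power3_eq_cube algebra_simps)
qed

section \<open>Root polynomials and Lagrange weights\<close>

definition root_poly :: "'a::idom set \<Rightarrow> 'a poly" where
  "root_poly A = (\<Prod>a\<in>A. [:-a, 1:])"

lemma degree_root_poly: "finite A \<Longrightarrow> degree (root_poly A) = card A"
  unfolding root_poly_def by (subst degree_prod_eq_sum_degree) auto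

lemma coeff_root_poly_card: "finite A \<Longrightarrow> coeff (root_poly A) (card A) = 1"
  using lead_coeff_prod[of "\<lambda>a. [:-a, 1:]" A] degree_root_poly[of A]
  by (simp add: root_poly_def)

lemma root_poly_nonzero: "finite A \<Longrightarrow> root_poly A \<noteq> 0"
  using coeff_root_poly_card[of A] by auto

lemma poly_root_poly_eq_0_iff: "finite A \<Longrightarrow> poly (root_poly A) x = 0 \<longleftrightarrow> x \<in> A"
  by (auto simp: root_poly_def poly_prod)

lemma root_poly_remove:
  "finite A \<Longrightarrow> a \<in> A \<Longrightarrow> root_poly A = [:-a, 1:] * root_poly (A - {a})"
  unfolding root_poly_def by (rule prod.remove)

lemma root_poly_translate: "root_poly ((\<lambda>x. x - c) ` A) = pcompose (root_poly A) [:c, 1:]"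
proof -
  have "root_poly ((\<lambda>x. x - c) ` A) = (\<Prod>a\<in>A. [:-(a - c), 1:])"
    unfolding root_poly_def by (subst prod.reindex) (auto simp: inj_on_def)
  then show ?thesis
    by (simp add: root_poly_def pcompose_prod)
qed

lemma coeff_root_poly_pred:
  "finite A \<Longrightarrow> A \<noteq> {} \<Longrightarrow> coeff (root_poly A) (card A - 1) = - \<Sum>A"
proof (induction A rule: finite_ne_induct)
  case (singleton x)
  then show ?case by (simp add: root_poly_def)
next
  case (insert x F)
  obtain k where k: "card F = Suc k" using insert by (cases "card F") auto
  have "root_poly (insert x F) = [:-x, 1:] * root_poly F"
    using insert by (simp add: root_poly_def)
  then show ?case
    using insert k coeff_root_poly_card[of F] by (simp add: coeff_pCons split: nat.split)
qed

lemma root_poly_centredE: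
  assumes "finite A" "2 \<le> card A" "\<Sum>A = 0"
  obtains R where "root_poly A = monom 1 (card A) + R" "R \<noteq> 0" "degree R + 2 \<le> card A"
proof
  let ?R = "root_poly A - monom 1 (card A)"
  show "root_poly A = monom 1 (card A) + ?R" by simp
  show "?R \<noteq> 0"
  proof
    assume "?R = 0"
    then have "root_poly A = monom 1 (card A)" by simp
    then have "A \<subseteq> {0}"
      using poly_root_poly_eq_0_iff[OF assms(1)] by (auto simp: poly_monom)
    then show False using card_mono[of "{0}" A] assms(2) by simp
  qed
  have "coeff ?R i = 0" if i: "card A - 2 < i" for i
  proof -
    consider (pred) "i = card A - 1" | (top) "i = card A" | (above) "card A < i"
      using i by linarith
    then show ?thesis
    proof cases
      case pred
      then show ?thesis using coeff_root_poly_pred[OF assms(1)] assms by fastforce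
    next
      case top
      then show ?thesis using coeff_root_poly_card[OF assms(1)] by simp
    next
      case above
      then show ?thesis using degree_root_poly[OF assms(1)] by (simp add: coeff_eq_0)
    qed
  qed
  then have "degree ?R \<le> card A - 2" by (intro degree_le) auto
  then show "degree ?R + 2 \<le> card A" using assms(2) by linarith
qed

lemma root_poly_power_dvd:
  assumes "finite A" "\<And>a. a \<in> A \<Longrightarrow> [:-a, 1:] ^ k dvd f"
  shows "root_poly A ^ k dvd f"
  using assms
proof (induction A arbitrary: f rule: finite_induct)
  case empty
  then show ?case by (simp add: root_poly_def)
next
  case (insert x F)
  then have "[:-x, 1:] ^ k dvd f" by simp
  then obtain g where g: "f = [:-x, 1:] ^ k * g" by (elim dvdE)
  have "[:-a, 1:] ^ k dvd g" if a: "a \<in> F" for a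
  proof (cases "g = 0")
    case False
    have "a \<noteq> x" using a insert by auto
    then have "order a ([:-x, 1:] ^ k) = 0" by (intro order_0I) simp
    moreover have "f \<noteq> 0" using False g by simp
    ultimately have "order a f = order a g" using g by (simp add: order_mult)
    then show ?thesis using insert.prems[of a] a \<open>f \<noteq> 0\<close> by (simp add: order_divides)
  qed simp
  then have "root_poly F ^ k dvd g" by (rule insert.IH)
  then show ?case using insert.hyps g
    by (simp add: root_poly_def power_mult_distrib mult_dvd_mono del: mult_pCons_left)
qed

definition lagrange_weight :: "'a::field set \<Rightarrow> 'a \<Rightarrow> 'a" where
  "lagrange_weight A a = inverse (\<Prod>b\<in>A - {a}. a - b)"

lemma lagrange_weight_translate:
  "lagrange_weight ((\<lambda>x. x - c) ` A) (a - c) = lagrange_weight A a"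
proof -
  have "(\<lambda>x. x - c) ` A - {a - c} = (\<lambda>x. x - c) ` (A - {a})" by auto
  then show ?thesis
    unfolding lagrange_weight_def
    by (simp, subst prod.reindex) (auto simp: inj_on_def)
qed

lemma lagrange_weight_remove:
  assumes "finite A" "c \<in> A" "a \<noteq> c"
  shows "lagrange_weight A a = lagrange_weight (A - {c}) a * inverse (a - c)"
proof -
  have "(\<Prod>b\<in>A - {a}. a - b) = (a - c) * (\<Prod>b\<in>A - {a} - {c}. a - b)"
    using assms by (intro prod.remove) auto
  moreover have "A - {a} - {c} = A - {c} - {a}" by auto
  ultimately show ?thesis by (simp add: lagrange_weight_def)
qed

lemma lagrange_interpolation:
  assumes "finite A" "degree q < card A"
  shows "q = (\<Sum>a\<in>A. smult (poly q a * lagrange_weight A a) (root_poly (A - {a})))"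
    (is "q = ?L")
proof (rule poly_eqI_degree[of A])
  fix x assume x: "x \<in> A"
  have "poly (smult (poly q a * lagrange_weight A a) (root_poly (A - {a}))) x
      = (if a = x then poly q x else 0)" for a
  proof (cases "a = x")
    case True
    have "(\<Prod>b\<in>A - {x}. x - b) \<noteq> 0" using assms(1) by simp
    then show ?thesis using True by (simp add: lagrange_weight_def root_poly_def poly_prod)
  next
    case False
    then show ?thesis using x assms(1) by (simp add: poly_root_poly_eq_0_iff)
  qed
  then show "poly q x = poly ?L x"
    using x assms(1) by (simp only: poly_sum sum.delta if_True)
next
  have "degree ?L \<le> card A - 1"
    using assms(1)
    by (intro degree_sum_le order.trans[OF degree_smult_le]) (auto simp: degree_root_poly)
  then show "degree ?L < card A" using assms(2) by linarith
qed (use assms in auto)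

lemma sum_lagrange_weight_poly:
  assumes "finite A" "degree q < card A"
  shows "(\<Sum>a\<in>A. lagrange_weight A a * poly q a) = coeff q (card A - 1)"
proof -
  have "coeff q (card A - 1)
      = (\<Sum>a\<in>A. poly q a * lagrange_weight A a * coeff (root_poly (A - {a})) (card A - 1))"
    by (subst lagrange_interpolation[OF assms]) (simp add: coeff_sum)
  also have "\<dots> = (\<Sum>a\<in>A. lagrange_weight A a * poly q a)"
  proof (rule sum.cong[OF refl])
    fix a assume "a \<in> A"
    then have "coeff (root_poly (A - {a})) (card A - 1) = 1"
      using assms(1) coeff_root_poly_card[of "A - {a}"] by simp
    then show "poly q a * lagrange_weight A a * coeff (root_poly (A - {a})) (card A - 1)
        = lagrange_weight A a * poly q a" by simp
  qed
  finally show ?thesis by simp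
qed

definition lagrange_moment :: "'a::field set \<Rightarrow> nat \<Rightarrow> 'a" where
  "lagrange_moment A k = (\<Sum>a\<in>A. lagrange_weight A a * a ^ k)"

lemma lagrange_moment_less_card:
  assumes "finite A" "k < card A"
  shows "lagrange_moment A k = (if k = card A - 1 then 1 else 0)"
  using sum_lagrange_weight_poly[of A "monom 1 k"] assms
  by (auto simp: lagrange_moment_def poly_monom degree_monom_eq)

lemma lagrange_moment_beyond_card:
  assumes "finite A" "root_poly A = monom 1 (card A) + R" "degree R + j = card A" "0 < j"
  shows "lagrange_moment A (card A - 1 + j) = - lead_coeff R"
proof -
  define q where "q = - (monom 1 (j - 1) * R)"
  have "degree q \<le> j - 1 + degree R"
    using degree_mult_le[of "monom 1 (j - 1)" R] by (simp add: q_def degree_monom_eq)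
  then have "degree q < card A" using assms(3,4) by linarith
  moreover have "a ^ (card A - 1 + j) = poly q a" if "a \<in> A" for a
  proof -
    have "poly R a = - (a ^ card A)"
      using that poly_root_poly_eq_0_iff[of A a] assms(1)
      by (simp add: assms(2) poly_monom eq_neg_iff_add_eq_0 add.commute)
    moreover have "card A - 1 + j = j - 1 + card A" using assms(3,4) by linarith
    ultimately show ?thesis by (simp add: q_def poly_monom power_add)
  qed
  ultimately have "lagrange_moment A (card A - 1 + j) = coeff q (card A - 1)"
    using sum_lagrange_weight_poly[OF assms(1), of q] by (simp add: lagrange_moment_def)
  moreover have "card A - 1 = j - 1 + degree R" using assms(3,4) by linarith
  then have "coeff q (card A - 1) = - lead_coeff R" by (simp add: q_def coeff_monom_mult)
  ultimately show ?thesis by simp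
qed

lemma fps_nth_inverse_root_poly:
  assumes "finite A" "A \<noteq> {}" "0 \<notin> A"
  shows "fps_nth (inverse (fps_of_poly (root_poly A))) k
    = - (\<Sum>a\<in>A. lagrange_weight A a * inverse a ^ Suc k)"
proof -
  define G where "G a = Abs_fps (\<lambda>k. - (inverse a ^ Suc k))" for a :: 'a
  have linear_mult_G: "fps_of_poly [:-a, 1:] * G a = 1" if "a \<in> A" for a
  proof (rule fps_ext)
    fix k
    have "a \<noteq> 0" using that assms(3) by auto
    then show "fps_nth (fps_of_poly [:-a, 1:] * G a) k = fps_nth 1 k"
      by (cases k) (simp_all add: G_def fps_of_poly_pCons distrib_right)
  qed
  have split: "fps_of_poly (root_poly A)
      = fps_of_poly [:-a, 1:] * fps_of_poly (root_poly (A - {a}))" if "a \<in> A" for a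
    by (subst root_poly_remove[OF assms(1) that]) (rule fps_of_poly_mult)
  have "fps_of_poly (root_poly A) * (\<Sum>a\<in>A. fps_const (lagrange_weight A a) * G a)
      = (\<Sum>a\<in>A. fps_const (lagrange_weight A a) * fps_of_poly (root_poly (A - {a}))
          * (fps_of_poly [:-a, 1:] * G a))"
    unfolding sum_distrib_left by (intro sum.cong refl) (subst split, simp_all only: mult_ac)
  also have "\<dots> = fps_of_poly (\<Sum>a\<in>A. smult (lagrange_weight A a) (root_poly (A - {a})))"
    by (simp add: linear_mult_G fps_of_poly_sum fps_of_poly_smult)
  also have "\<dots> = 1"
    using lagrange_interpolation[OF assms(1), of 1] assms by (simp add: card_gt_0_iff)
  finally have "inverse (fps_of_poly (root_poly A))
      = (\<Sum>a\<in>A. fps_const (lagrange_weight A a) * G a)"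
    by (rule fps_inverse_unique)
  then show ?thesis by (simp add: fps_sum_nth G_def sum_negf)
qed

definition local_factor :: "'a::field set \<Rightarrow> 'a fps" where
  "local_factor A = fps_const (inverse (coeff (root_poly (A - {0})) 0))
     * fps_of_poly (root_poly (A - {0}))"

lemma coeff_root_poly_remove_0_nonzero: "finite A \<Longrightarrow> coeff (root_poly (A - {0})) 0 \<noteq> 0"
  using poly_root_poly_eq_0_iff[of "A - {0}" 0] by (simp add: poly_0_coeff_0)

lemma fps_nth_local_factor_0: "finite A \<Longrightarrow> fps_nth (local_factor A) 0 = 1"
  using coeff_root_poly_remove_0_nonzero[of A] by (simp add: local_factor_def)

lemma coeff_Suc_root_poly_eq_local_factor:
  assumes "finite A" "0 \<in> A"
  shows "coeff (root_poly A) (Suc i) = coeff (root_poly A) 1 * fps_nth (local_factor A) i"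
  using root_poly_remove[OF assms] coeff_root_poly_remove_0_nonzero[OF assms(1)]
  by (simp add: local_factor_def)

definition stepanov_poly :: "'a::field set \<Rightarrow> nat \<Rightarrow> 'a poly" where
  "stepanov_poly A N = (\<Sum>a\<in>A. smult (lagrange_weight A a) ([:-a, 1:] ^ N))"

lemma coeff_stepanov_poly:
  assumes "i \<le> N"
  shows "coeff (stepanov_poly A N) i
    = (-1) ^ (N - i) * of_nat (N choose i) * lagrange_moment A (N - i)"
proof -
  have "coeff (stepanov_poly A N) i
      = of_nat (N choose i) * (\<Sum>a\<in>A. lagrange_weight A a * (-a) ^ (N - i))"
    using assms
    by (simp add: stepanov_poly_def coeff_sum coeff_linear_poly_power sum_distrib_left mult_ac)
  also have "(\<Sum>a\<in>A. lagrange_weight A a * (-a) ^ (N - i))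
      = (-1) ^ (N - i) * lagrange_moment A (N - i)"
    unfolding lagrange_moment_def sum_distrib_left
    by (intro sum.cong refl) (subst power_minus, simp)
  finally show ?thesis by simp
qed

lemma degree_stepanov_poly: "degree (stepanov_poly A N) \<le> N"
  unfolding stepanov_poly_def
  by (cases "finite A") (auto intro!: degree_sum_le order.trans[OF degree_smult_le]
      simp: degree_linear_power)

lemma stepanov_poly_translate:
  "stepanov_poly ((\<lambda>x. x - c) ` A) N = pcompose (stepanov_poly A N) [:c, 1:]"
proof -
  have "stepanov_poly ((\<lambda>x. x - c) ` A) N
      = (\<Sum>a\<in>A. smult (lagrange_weight A a) ([:-(a - c), 1:] ^ N))"
    unfolding stepanov_poly_def
    by (subst sum.reindex) (auto simp: inj_on_def lagrange_weight_translate)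
  then show ?thesis
    by (simp add: stepanov_poly_def pcompose_sum pcompose_smult pcompose_hom.hom_power)
qed

section \<open>The fourth transvectant\<close>

text \<open>
  Up to a constant and modulo dehomogenization, the fourth transvectant with itself of the binary form
  of degree \<open>n + 1\<close> given by a polynomial \<open>p\<close> of degree \<open>n\<close>.
\<close>

definition transvectant4 :: "'a::idom \<Rightarrow> 'a poly \<Rightarrow> 'a poly" where
  "transvectant4 n p = smult (n * (n + 1)) (p * (pderiv ^^ 4) p)
     - smult (4 * n * (n - 2)) (pderiv p * (pderiv ^^ 3) p)
     + smult (3 * (n - 1) * (n - 2)) ((pderiv ^^ 2) p * (pderiv ^^ 2) p)"

lemma transvectant4_pcompose_shift:
  "transvectant4 n (pcompose p [:c, 1:]) = pcompose (transvectant4 n p) [:c, 1:]"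
  by (simp add: transvectant4_def higher_pderiv_pcompose_shift pderiv_pcompose pderiv_pCons
      pcompose_add pcompose_diff pcompose_smult pcompose_mult del: funpow.simps)

lemma degree_transvectant4_less:
  assumes "2 \<le> degree p"
  shows "degree (transvectant4 n p) < 2 * degree p"
proof -
  have "degree ((pderiv ^^ k) p * (pderiv ^^ l) p) \<le> 2 * degree p - 1"
    if "k + l = 4" "k \<le> 2" for k l
    using degree_mult_le[of "(pderiv ^^ k) p" "(pderiv ^^ l) p"] degree_higher_pderiv_le[of k p]
      degree_higher_pderiv_le[of l p] assms that by linarith
  from this[of 0 4] this[of 1 3] this[of 2 2]
  have "degree (transvectant4 n p) \<le> 2 * degree p - 1"
    unfolding transvectant4_def
    by (intro degree_add_le degree_diff_le order.trans[OF degree_smult_le]) auto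
  then show ?thesis using assms by linarith
qed

lemma coeff_transvectant4_at_root:
  fixes p :: "'a::idom poly"
  assumes "coeff p 0 = 0"
  shows "coeff (transvectant4 n p) 0
      = - 12 * (n - 2) * (2 * n * coeff p 1 * coeff p 3 - (n - 1) * (coeff p 2)\<^sup>2)"
    and "coeff (transvectant4 n p) 1
      = - 24 * (n - 3) * (3 * n * coeff p 1 * coeff p 4 - (n - 2) * coeff p 2 * coeff p 3)"
proof -
  have mult_1: "coeff (f * g) (Suc 0) = coeff f 0 * coeff g (Suc 0) + coeff f (Suc 0) * coeff g 0"
    for f g :: "'a poly"
    by (simp add: coeff_mult)
  note expand = transvectant4_def coeff_mult_0 mult_1 eval_nat_numeral coeff_pderiv assms algebra_simps
  show "coeff (transvectant4 n p) 0
      = - 12 * (n - 2) * (2 * n * coeff p 1 * coeff p 3 - (n - 1) * (coeff p 2)\<^sup>2)"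
    by (simp add: expand)
  show "coeff (transvectant4 n p) 1
      = - 24 * (n - 3) * (3 * n * coeff p 1 * coeff p 4 - (n - 2) * coeff p 2 * coeff p 3)"
    by (simp add: expand)
qed

lemma monom_mult_transvectant4:
  fixes p :: "'a::idom poly"
  defines "D \<equiv> \<lambda>k. monom 1 k * (pderiv ^^ k) p"
  shows "monom 1 4 * transvectant4 n p = smult (n * (n + 1)) (D 0 * D 4)
     - smult (4 * n * (n - 2)) (D 1 * D 3) + smult (3 * (n - 1) * (n - 2)) (D 2 * D 2)"
proof -
  have "D k * D l = monom 1 4 * ((pderiv ^^ k) p * (pderiv ^^ l) p)" if "k + l = 4" for k l
  proof -
    have "monom 1 4 = monom 1 k * (monom 1 l :: 'a poly)" using that by (simp add: mult_monom)
    then show ?thesis by (simp add: D_def mult_ac del: funpow.simps)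
  qed
  from this[of 0 4] this[of 1 3] this[of 2 2] show ?thesis
    by (simp add: transvectant4_def distrib_left right_diff_distrib mult_smult_right)
qed

lemma coeff_monom_mult_transvectant4_top:
  fixes R :: "'a::idom poly" and n m :: nat
  assumes "degree R \<le> m" "m < n"
  defines "x \<equiv> of_nat n" and "y \<equiv> of_nat n - of_nat m"
  shows "coeff (monom 1 4 * transvectant4 x (monom 1 n + R)) (n + m)
    = coeff R m * x * (y + 1) * y * (y - 1) * ((y - 6) * (x + 1) + 12)"
proof -
  let ?p = "monom 1 n + R"
  let ?D = "\<lambda>k. monom 1 k * (pderiv ^^ k) ?p"
  have coeff_D: "coeff (?D k) i = (\<Prod>l<k. of_nat i - of_nat l) * coeff ?p i" for k i
    by (rule coeff_monom_mult_higher_pderiv)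
  have gap: "coeff ?p i = 0" if "m < i" "i \<noteq> n" for i
    using that assms(1) by (simp add: coeff_eq_0)
  have coeff_D_mult: "coeff (?D k * ?D l) (n + m)
      = coeff (?D k) n * coeff (?D l) m + coeff (?D k) m * coeff (?D l) n" for k l
    by (rule coeff_mult_two_top_terms[OF assms(2)]) (simp_all add: coeff_D gap del: coeff_add)
  have "coeff ?p n = 1" "coeff ?p m = coeff R m" using assms(1,2) by (simp_all add: coeff_eq_0)
  then show ?thesis
    unfolding monom_mult_transvectant4 coeff_add coeff_diff coeff_smult coeff_D_mult coeff_D
      x_def y_def
    by (simp add: eval_nat_numeral algebra_simps)
qed

section \<open>Sets with differences in the roots of unity\<close>

locale unit_differences =
  fixes A :: "'a::field set" and n :: nat
  assumes finite_A: "finite A" and card_A: "card A = n" and n_ge_4: "4 \<le> n"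
    and unit_diff: "\<And>a b. a \<in> A \<Longrightarrow> b \<in> A \<Longrightarrow> a \<noteq> b \<Longrightarrow> (a - b) ^ (n * (n - 1)) = 1"
    and large_char: "\<And>k. 0 < k \<Longrightarrow> k < n ^ 2 \<Longrightarrow> of_nat k \<noteq> (0::'a)"
begin

definition d :: nat where "d = n * (n - 1)"
definition N :: nat where "N = d + (n - 1)"
definition binom :: "nat \<Rightarrow> 'a" where "binom i = of_nat (N choose (n - 1 + i))"
abbreviation P :: "'a poly" where "P \<equiv> root_poly A"

lemma even_d: "even d"
  by (auto simp: d_def)

lemma unit_power_d: "0 \<in> A \<Longrightarrow> a \<in> A \<Longrightarrow> a \<noteq> 0 \<Longrightarrow> a ^ d = 1"
  using unit_diff[of a 0] by (simp add: d_def)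

lemma unit_differences_translate: "unit_differences ((\<lambda>x. x - c) ` A) n"
proof
  show "card ((\<lambda>x. x - c) ` A) = n" using card_A by (subst card_image) (auto simp: inj_on_def)
qed (use finite_A n_ge_4 unit_diff large_char in auto)

lemma n_squared_eq: "n ^ 2 = d + n"
  using n_ge_4 by (simp add: d_def power2_eq_square diff_mult_distrib2)

lemma four_n_le: "4 * n \<le> n ^ 2"
  using n_ge_4 by (simp add: power2_eq_square)

lemma n_less_d: "n < d"
  using n_ge_4 mult_less_mono2[of 1 "n - 1" n] by (simp add: d_def)

lemma three_less_d: "3 < d"
  using n_less_d n_ge_4 by linarith

lemma degree_P: "degree P = n"
  using degree_root_poly finite_A card_A by blast

lemma minus_one_power_d_diff: "i \<le> d \<Longrightarrow> (-1) ^ (d - i) = ((-1) ^ i :: 'a)"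
  using even_d by (simp add: minus_one_power_iff)

lemma binom_0_nonzero: "binom 0 \<noteq> 0"
proof -
  have "of_nat m \<noteq> (0::'a)" if "m \<in> {1..N}" for m
    using that n_ge_4 by (intro large_char) (auto simp: n_squared_eq N_def)
  then have "of_nat (fact N) \<noteq> (0::'a)" by (simp add: fact_prod)
  moreover have "n - 1 \<le> N" by (simp add: N_def)
  ultimately show ?thesis
    unfolding binom_def using binomial_fact_lemma[of "n - 1" N]
    by (metis add_0_right mult_zero_right of_nat_mult)
qed

lemma lagrange_moment_periodic:
  assumes "0 \<in> A" "0 < k"
  shows "lagrange_moment A (d + k) = lagrange_moment A k"
  unfolding lagrange_moment_def
proof (rule sum.cong[OF refl])
  fix a assume "a \<in> A"
  then show "lagrange_weight A a * a ^ (d + k) = lagrange_weight A a * a ^ k"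
    using assms unit_power_d by (cases "a = 0") (simp_all add: power_add)
qed

lemma lagrange_moment_reflect:
  assumes "0 \<in> A" "k < d"
  shows "lagrange_moment A (d - k) = - fps_nth (inverse (fps_of_poly (root_poly (A - {0})))) k"
proof -
  let ?B = "A - {0}"
  have "lagrange_weight A a * a ^ (d - k) = lagrange_weight ?B a * inverse a ^ Suc k"
    if "a \<in> ?B" for a
  proof -
    have "a ^ k * a ^ (d - k) = 1"
      using unit_power_d that assms by (simp flip: power_add)
    then have "a ^ (d - k) = inverse a ^ k" by (metis inverse_unique power_inverse)
    then show ?thesis
      using that by (subst lagrange_weight_remove[OF finite_A assms(1)]) simp_all
  qed
  then have "lagrange_moment A (d - k) = (\<Sum>a\<in>?B. lagrange_weight ?B a * inverse a ^ Suc k)"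
    using assms(2) by (simp add: lagrange_moment_def sum.remove[OF finite_A assms(1)])
  moreover have "?B \<noteq> {}"
    using card_A n_ge_4 card_mono[of "{0}" A] by auto
  ultimately show ?thesis using fps_nth_inverse_root_poly[of ?B k] finite_A by simp
qed

lemma coeff_stepanov_poly_low:
  assumes "0 \<in> A" "i < n - 1"
  shows "coeff (stepanov_poly A N) i = (if i = 0 then (-1) ^ (n - 1) else 0)"
proof -
  have "N - i = d + (n - 1 - i)" using assms(2) by (simp add: N_def)
  then have "lagrange_moment A (N - i) = lagrange_moment A (n - 1 - i)"
    using lagrange_moment_periodic[OF assms(1), of "n - 1 - i"] assms(2) by simp
  moreover have "(-1) ^ N = ((-1) ^ (n - 1) :: 'a)" using even_d by (simp add: N_def power_add)
  ultimately show ?thesis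
    using assms(2) lagrange_moment_less_card[OF finite_A, of "n - 1 - i"] card_A
    by (auto simp: coeff_stepanov_poly N_def)
qed

lemma coeff_stepanov_poly_high:
  assumes "d \<le> i"
  shows "coeff (stepanov_poly A N) i = (if i = d then (-1) ^ (n - 1) * binom 0 else 0)"
proof (cases "i \<le> N")
  case True
  then have "lagrange_moment A (N - i) = (if i = d then 1 else 0)"
    using lagrange_moment_less_card[OF finite_A, of "N - i"] card_A assms n_ge_4
    by (auto simp: N_def)
  moreover have "N choose d = N choose (n - 1)"
    using binomial_symmetric[of d N] by (simp add: N_def)
  ultimately show ?thesis using True by (simp add: coeff_stepanov_poly N_def binom_def)
next
  case False
  then show ?thesis using degree_stepanov_poly[of A N] assms by (simp add: coeff_eq_0 N_def)
qed

lemma root_poly_power_dvd_stepanov_poly_minus_const: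
  "P ^ (n - 1) dvd stepanov_poly A N - [:(-1) ^ (n - 1):]"
proof (rule root_poly_power_dvd[OF finite_A])
  fix a assume a: "a \<in> A"
  interpret T: unit_differences "(\<lambda>x. x - a) ` A" n by (rule unit_differences_translate)
  have "0 \<in> (\<lambda>x. x - a) ` A" using a by force
  from T.coeff_stepanov_poly_low[OF this]
  show "[:-a, 1:] ^ (n - 1) dvd stepanov_poly A N - [:(-1) ^ (n - 1):]"
    by (auto simp: linear_power_dvd_iff_coeff_pcompose pcompose_diff stepanov_poly_translate
        coeff_pCons split: nat.split)
qed

lemma stepanov_poly_eq:
  "stepanov_poly A N = smult ((-1) ^ (n - 1)) (1 + smult (binom 0) (P ^ (n - 1)))"
proof -
  define e :: 'a where "e = (-1) ^ (n - 1)"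
  define f where "f = stepanov_poly A N - [:e:] - smult (e * binom 0) (P ^ (n - 1))"
  have deg: "degree (P ^ (n - 1)) = d"
    using root_poly_nonzero[OF finite_A] by (simp add: degree_power_eq degree_P d_def mult.commute)
  have lead: "coeff (P ^ (n - 1)) d = 1"
    using coeff_power_degree_le[of P n "n - 1"] coeff_root_poly_card[OF finite_A]
    by (simp add: degree_P card_A d_def)
  have dvd: "P ^ (n - 1) dvd f"
    unfolding f_def e_def
    by (intro dvd_diff[OF root_poly_power_dvd_stepanov_poly_minus_const] dvd_smult dvd_refl)
  have "coeff f i = 0" if "d \<le> i" for i
    using that three_less_d lead deg coeff_stepanov_poly_high[OF that]
    by (cases "i = d") (auto simp: f_def e_def coeff_eq_0 coeff_pCons split: nat.split)
  then have "f = 0 \<or> degree f < d" by (metis leI leading_coeff_0_iff)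
  then have "f = 0" using dvd_imp_degree_le[OF dvd] deg by (metis not_le)
  then show ?thesis by (simp add: f_def e_def smult_add_right algebra_simps one_pCons)
qed

lemma inverse_root_poly_remove_0_expansion:
  assumes zero: "0 \<in> A" and "i < d"
  defines "F \<equiv> fps_of_poly (root_poly (A - {0}))"
  shows "binom i * ((-1) ^ i * fps_nth (inverse F) i)
    = (-1) ^ n * binom 0 * fps_nth (F ^ (n - 1)) i"
proof -
  have "P = monom 1 1 * root_poly (A - {0})"
    using root_poly_remove[OF finite_A zero] by (simp add: monom_altdef)
  then have "P ^ (n - 1) = monom 1 (n - 1) * root_poly (A - {0}) ^ (n - 1)"
    by (simp add: power_mult_distrib monom_power)
  then have "coeff (P ^ (n - 1)) (n - 1 + i) = fps_nth (F ^ (n - 1)) i"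
    by (simp add: F_def coeff_monom_mult flip: fps_of_poly_power)
  then have "coeff (stepanov_poly A N) (n - 1 + i)
      = (-1) ^ (n - 1) * binom 0 * fps_nth (F ^ (n - 1)) i"
    unfolding stepanov_poly_eq using n_ge_4 by simp
  moreover have "N - (n - 1 + i) = d - i" "n - 1 + i \<le> N" using assms(2) by (simp_all add: N_def)
  then have "coeff (stepanov_poly A N) (n - 1 + i)
      = - (binom i * ((-1) ^ i * fps_nth (inverse F) i))"
    using coeff_stepanov_poly[of "n - 1 + i" N A] lagrange_moment_reflect[OF zero assms(2)] assms(2)
    by (simp add: binom_def F_def minus_one_power_d_diff mult_ac)
  moreover have "(-1) ^ n = - ((-1) ^ (n - 1) :: 'a)"
    using n_ge_4 by (cases n) simp_all
  ultimately show ?thesis by simp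
qed

lemma local_factor_expansion:
  assumes zero: "0 \<in> A" and "i < d"
  shows "binom i * ((-1) ^ i * fps_nth (inverse (local_factor A)) i)
    = binom 0 * fps_nth (local_factor A ^ (n - 1)) i"
proof -
  let ?F = "fps_of_poly (root_poly (A - {0}))"
  define c where "c = coeff (root_poly (A - {0})) 0"
  have c: "c \<noteq> 0" using coeff_root_poly_remove_0_nonzero[OF finite_A] by (simp add: c_def)
  note match = inverse_root_poly_remove_0_expansion[OF zero]
  have "binom 0 * inverse c = binom 0 * ((-1) ^ n * c ^ (n - 1))"
    using match[of 0] three_less_d by (simp add: c_def fps_power_zeroth mult_ac)
  then have "inverse c = (-1) ^ n * c ^ (n - 1)"
    using binom_0_nonzero by (simp only: mult_cancel_left) simp
  then have sign: "c * (-1) ^ n = inverse c ^ (n - 1)"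
    using c by (simp add: field_simps)
  have "inverse (local_factor A) = fps_const c * inverse ?F"
    using c by (simp add: local_factor_def c_def fps_inverse_mult fps_const_inverse)
  then have "binom i * ((-1) ^ i * fps_nth (inverse (local_factor A)) i)
      = c * (binom i * ((-1) ^ i * fps_nth (inverse ?F) i))"
    by (simp add: mult_ac)
  also have "\<dots> = binom 0 * (inverse c ^ (n - 1) * fps_nth (?F ^ (n - 1)) i)"
    unfolding match[OF assms(2)] sign[symmetric] by (simp add: mult_ac)
  also have "\<dots> = binom 0 * fps_nth (local_factor A ^ (n - 1)) i"
    by (simp add: local_factor_def c_def power_mult_distrib fps_const_power)
  finally show ?thesis .
qed

lemma linear_factors_nonzero:
  "of_nat n \<noteq> (0::'a)" "of_nat n - 1 \<noteq> (0::'a)" "of_nat n - 3 \<noteq> (0::'a)"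
  "of_nat n + 1 \<noteq> (0::'a)" "(2::'a) \<noteq> 0"
proof -
  have "of_nat n \<noteq> (0::'a)" "of_nat (n - 1) \<noteq> (0::'a)" "of_nat (n - 3) \<noteq> (0::'a)"
    "of_nat (n + 1) \<noteq> (0::'a)" "of_nat 2 \<noteq> (0::'a)"
    using n_ge_4 four_n_le by (intro large_char; linarith)+
  then show "of_nat n \<noteq> (0::'a)" "of_nat n - 1 \<noteq> (0::'a)" "of_nat n - 3 \<noteq> (0::'a)"
    "of_nat n + 1 \<noteq> (0::'a)" "(2::'a) \<noteq> 0"
    using n_ge_4 by (simp_all add: of_nat_diff add.commute)
qed

lemma binom_Suc:
  assumes "i < d"
  shows "(of_nat n + of_nat i) * binom (Suc i) = (of_nat n * (of_nat n - 1) - of_nat i) * binom i"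
proof -
  have "N = Suc (n - 1 + i + (d - Suc i))" using assms n_ge_4 by (simp add: N_def)
  then have "(n + i) * (N choose (n - 1 + Suc i)) = (d - i) * (N choose (n - 1 + i))"
    using Suc_times_binomial_add[of "n - 1 + i" "d - Suc i"] assms n_ge_4
    by (simp add: Suc_diff_Suc)
  then have "of_nat (n + i) * binom (Suc i) = of_nat (d - i) * binom i"
    unfolding binom_def by (simp only: flip: of_nat_mult)
  then show ?thesis using assms n_ge_4 by (simp add: of_nat_diff d_def)
qed

lemma binom_2_3:
  fixes x :: 'a
  defines "x \<equiv> of_nat n"
  shows "(x + 1) * binom 2 = (x * (x - 1) - 1) * (x - 1) * binom 0"
    and "(x + 2) * binom 3 = (x - 2) * (x * (x - 1) - 1) * (x - 1) * binom 0"
proof -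
  have ratio: "(x + of_nat i) * binom (Suc i) = (x * (x - 1) - of_nat i) * binom i" if "i < 3" for i
    unfolding x_def using that three_less_d by (intro binom_Suc) simp
  have "x * binom 1 = x * ((x - 1) * binom 0)" using ratio[of 0] by (simp add: mult_ac)
  then have "binom 1 = (x - 1) * binom 0" using linear_factors_nonzero by (simp add: x_def)
  then show second: "(x + 1) * binom 2 = (x * (x - 1) - 1) * (x - 1) * binom 0"
    using ratio[of 1] by (simp add: numeral_2_eq_2 mult_ac)
  have "(x + 2) * binom 3 = (x - 2) * ((x + 1) * binom 2)"
    using ratio[of 2] by (simp add: numeral_3_eq_3 algebra_simps)
  then show "(x + 2) * binom 3 = (x - 2) * (x * (x - 1) - 1) * (x - 1) * binom 0"
    unfolding second by (simp add: mult_ac)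
qed

lemma local_factor_second:
  assumes "0 \<in> A"
  defines "f \<equiv> fps_nth (local_factor A)"
  shows "2 * of_nat n * f 2 = (of_nat n - 1) * (f 1)\<^sup>2"
proof -
  define x :: 'a where "x = of_nat n"
  define y where "y = fps_nth (local_factor A ^ (n - 1)) 2"
  note zeroth = fps_nth_local_factor_0[OF finite_A]
  have closed_form: "(x + 1) * binom 2 = (x * (x - 1) - 1) * (x - 1) * binom 0"
    unfolding x_def by (rule binom_2_3)
  have power: "2 * y = (x - 1) * (2 * f 2 + (x - 2) * (f 1)\<^sup>2)"
    using fps_power_second[OF zeroth, of "n - 1"] n_ge_4 by (simp add: y_def x_def f_def of_nat_diff)
  have expansion: "binom 2 * ((f 1)\<^sup>2 - f 2) = binom 0 * y"
    using local_factor_expansion[OF assms(1), of 2] three_less_d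
    by (simp add: y_def f_def fps_inverse_second_third[OF zeroth])
  have "binom 0 * (x - 1) * x * (2 * x * f 2 - (x - 1) * (f 1)\<^sup>2)
      = (x + 1) * binom 0 * (2 * y) - 2 * ((f 1)\<^sup>2 - f 2) * ((x + 1) * binom 2)"
    unfolding closed_form power by (simp add: algebra_simps power2_eq_square)
  also have "\<dots> = 2 * (x + 1) * (binom 0 * y - binom 2 * ((f 1)\<^sup>2 - f 2))"
    by (simp add: algebra_simps)
  also have "\<dots> = 0" unfolding expansion by simp
  finally show ?thesis using linear_factors_nonzero binom_0_nonzero by (simp add: x_def)
qed

lemma local_factor_third:
  assumes "0 \<in> A"
  defines "f \<equiv> fps_nth (local_factor A)"
  shows "3 * of_nat n * f 3 = (of_nat n - 2) * f 1 * f 2"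
proof -
  define x :: 'a where "x = of_nat n"
  define y where "y = fps_nth (local_factor A ^ (n - 1)) 3"
  define z where "z = f 1 ^ 3 + f 3 - 2 * f 1 * f 2"
  note zeroth = fps_nth_local_factor_0[OF finite_A]
  have closed_form: "(x + 2) * binom 3 = (x - 2) * (x * (x - 1) - 1) * (x - 1) * binom 0"
    unfolding x_def by (rule binom_2_3)
  have power: "6 * y = (x - 1) * (6 * f 3 + 6 * (x - 2) * f 1 * f 2 + (x - 2) * (x - 3) * f 1 ^ 3)"
    using fps_power_third[OF zeroth, of "n - 1"] n_ge_4 by (simp add: y_def x_def f_def of_nat_diff)
  have expansion: "binom 3 * z = binom 0 * y"
    using local_factor_expansion[OF assms(1), of 3] three_less_d
    by (simp add: y_def z_def f_def fps_inverse_second_third[OF zeroth] algebra_simps)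
  have second: "2 * x * f 2 - (x - 1) * (f 1)\<^sup>2 = 0"
    using local_factor_second[OF assms(1)] by (simp add: x_def f_def)
  have "2 * binom 0 * (x - 1) * x * (x - 3) * (3 * x * f 3 - (x - 2) * f 1 * f 2)
      = 5 * binom 0 * (x - 1) * x * (x - 2) * f 1 * (2 * x * f 2 - (x - 1) * (f 1)\<^sup>2)
        - (x + 2) * binom 0 * (6 * y) + 6 * z * ((x + 2) * binom 3)"
    unfolding closed_form power z_def by (simp add: algebra_simps power2_eq_square power3_eq_cube)
  also have "\<dots> = 6 * (x + 2) * (binom 3 * z - binom 0 * y)"
    unfolding second by (simp add: algebra_simps)
  also have "\<dots> = 0" unfolding expansion by simp
  finally show ?thesis using linear_factors_nonzero binom_0_nonzero by (simp add: x_def)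
qed

lemma coeff_transvectant4_root_poly_low:
  assumes zero: "0 \<in> A" and "i < 2"
  shows "coeff (transvectant4 (of_nat n) P) i = 0"
proof -
  define f where "f = fps_nth (local_factor A)"
  define c where "c = coeff P 1"
  have P0: "coeff P 0 = 0"
    using zero poly_root_poly_eq_0_iff[OF finite_A, of 0] by (simp add: poly_0_coeff_0)
  have P: "coeff P 1 = c" "coeff P 2 = c * f 1" "coeff P 3 = c * f 2" "coeff P 4 = c * f 3"
    using coeff_Suc_root_poly_eq_local_factor[OF finite_A zero, of 1]
      coeff_Suc_root_poly_eq_local_factor[OF finite_A zero, of 2]
      coeff_Suc_root_poly_eq_local_factor[OF finite_A zero, of 3]
    by (simp_all add: c_def f_def eval_nat_numeral)
  have "2 * of_nat n * coeff P 1 * coeff P 3 - (of_nat n - 1) * (coeff P 2)\<^sup>2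
      = c\<^sup>2 * (2 * of_nat n * f 2 - (of_nat n - 1) * (f 1)\<^sup>2)"
    unfolding P by (simp add: algebra_simps power2_eq_square)
  also have "\<dots> = 0" using local_factor_second[OF zero] by (simp add: f_def)
  finally have "coeff (transvectant4 (of_nat n) P) 0 = 0"
    unfolding coeff_transvectant4_at_root(1)[OF P0] by simp
  have "3 * of_nat n * coeff P 1 * coeff P 4 - (of_nat n - 2) * coeff P 2 * coeff P 3
      = c\<^sup>2 * (3 * of_nat n * f 3 - (of_nat n - 2) * f 1 * f 2)"
    unfolding P by (simp add: algebra_simps power2_eq_square)
  also have "\<dots> = 0" using local_factor_third[OF zero] by (simp add: f_def)
  finally have "coeff (transvectant4 (of_nat n) P) 1 = 0"
    unfolding coeff_transvectant4_at_root(2)[OF P0] by simp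
  with \<open>coeff (transvectant4 (of_nat n) P) 0 = 0\<close> show ?thesis
    using \<open>i < 2\<close> by (auto simp: less_2_cases_iff)
qed

lemma transvectant4_root_poly: "transvectant4 (of_nat n) P = 0"
proof (rule ccontr)
  assume nz: "transvectant4 (of_nat n) P \<noteq> 0"
  have "P ^ 2 dvd transvectant4 (of_nat n) P"
  proof (rule root_poly_power_dvd[OF finite_A])
    fix a assume a: "a \<in> A"
    interpret T: unit_differences "(\<lambda>x. x - a) ` A" n by (rule unit_differences_translate)
    have "0 \<in> (\<lambda>x. x - a) ` A" using a by force
    then have "coeff (transvectant4 (of_nat n) T.P) i = 0" if "i < 2" for i
      using that by (auto simp: less_2_cases_iff T.coeff_transvectant4_root_poly_low)
    then show "[:-a, 1:] ^ 2 dvd transvectant4 (of_nat n) P"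
      by (simp add: linear_power_dvd_iff_coeff_pcompose transvectant4_pcompose_shift[symmetric]
          root_poly_translate)
  qed
  from dvd_imp_degree_le[OF this nz] show False
    using degree_transvectant4_less[of P "of_nat n"] degree_P n_ge_4 root_poly_nonzero[OF finite_A]
    by (simp add: degree_power_eq)
qed

lemma of_int_eq_0D:
  assumes "of_int k = (0::'a)" "\<bar>k\<bar> < int (n ^ 2)"
  shows "k = 0"
proof (rule ccontr)
  assume "k \<noteq> 0"
  then have "of_nat (nat \<bar>k\<bar>) \<noteq> (0::'a)"
    using assms(2) by (intro large_char) (auto simp: nat_less_iff)
  moreover have "of_nat (nat \<bar>k\<bar>) = (of_int \<bar>k\<bar> :: 'a)" by (simp add: of_nat_nat)
  ultimately show False using assms(1) by (auto simp: abs_if split: if_splits)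
qed

end

section \<open>The exceptional cases\<close>

lemma gap_equation_solutions:
  fixes j n :: nat
  assumes eq: "(int j - 6) * (int n + 1) + 12 = 0" and "4 \<le> n" "2 \<le> j"
  shows "n = 5 \<and> j = 4 \<or> n = 11 \<and> j = 5"
proof -
  have "j < 6"
  proof (rule ccontr)
    assume "\<not> j < 6"
    then have "0 \<le> (int j - 6) * (int n + 1)" by simp
    then show False using eq by linarith
  qed
  then have "j = 2 \<or> j = 3 \<or> j = 4 \<or> j = 5" using assms(3) by auto
  then show ?thesis using eq assms(2) by (elim disjE) simp_all
qed

lemma abs_gap_expression_less:
  fixes j n :: nat
  assumes "4 \<le> n" "2 \<le> j" "j \<le> n"
  shows "\<bar>(int j - 6) * (int n + 1) + 12\<bar> < int (n ^ 2)"
proof (cases "6 \<le> j")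
  case True
  have "(int j - 6) * (int n + 1) \<le> (int n - 6) * (int n + 1)"
    using assms(3) by (intro mult_right_mono) auto
  moreover have "(int n - 6) * (int n + 1) + 12 < int (n ^ 2)"
    using assms(1) by (simp add: algebra_simps power2_eq_square)
  moreover have "0 \<le> (int j - 6) * (int n + 1)" using True by simp
  ultimately show ?thesis by linarith
next
  case False
  then have "j = 2 \<or> j = 3 \<or> j = 4 \<or> j = 5" using assms(2) by auto
  moreover have "4 * int n \<le> int (n ^ 2)" using assms(1) by (simp add: power2_eq_square)
  ultimately show ?thesis using assms(1) by (elim disjE) (simp_all del: of_nat_power)
qed

lemma choose_120:
  "120 choose 10 = (116068178638776 :: nat)" "120 choose 15 = (4730523156632595024 :: nat)"
  by (simp_all add: binomial_fact' fact_numeral)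

lemma prime_dvd_choose_24_le:
  assumes "prime p" "p dvd (24 choose 8) + 4 * (24 choose 4)"
  shows "p \<le> 41"
proof -
  have "24 choose 8 = (735471 :: nat)" "24 choose 4 = (10626 :: nat)"
    by (simp_all add: binomial_fact' fact_numeral)
  then have "(24 choose 8) + 4 * (24 choose 4) = (3 * 25 * 11 * 23 * 41 :: nat)" by simp
  then show ?thesis
    using assms(2) by (simp only: prime_dvd_mult_iff[OF assms(1)]) (auto dest: dvd_imp_le)
qed

lemma prime_dvd_choose_120_le:
  assumes "prime p" "p dvd (120 choose 15) - 10 * (120 choose 10)"
  shows "p \<le> 163"
proof -
  have "(120 choose 15) - 10 * (120 choose 10)
      = (32 * 3 * 121 * 17 * 19 * 23 * 29 * 37 * 47 * 59 * 113 * 163 :: nat)"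
    by (simp add: choose_120)
  then show ?thesis
    using assms(2) by (simp only: prime_dvd_mult_iff[OF assms(1)]) (auto dest!: dvd_imp_le)
qed

context unit_differences
begin

lemma gap_equation:
  assumes P: "P = monom 1 n + R" and "R \<noteq> 0" and j: "degree R + j = n" "2 \<le> j"
  shows "(int j - 6) * (int n + 1) + 12 = 0"
proof -
  have "of_nat n \<noteq> (0::'a)" "of_nat (j + 1) \<noteq> (0::'a)" "of_nat j \<noteq> (0::'a)"
    "of_nat (j - 1) \<noteq> (0::'a)"
    using j n_ge_4 four_n_le by (intro large_char; linarith)+
  then have nonzero: "of_nat n \<noteq> (0::'a)" "of_nat j + 1 \<noteq> (0::'a)" "of_nat j \<noteq> (0::'a)"
    "of_nat j - 1 \<noteq> (0::'a)"
    using j by (simp_all add: of_nat_diff add.commute)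
  have "of_nat n - of_nat (degree R) = (of_nat j :: 'a)"
    by (simp flip: j(1))
  then have "lead_coeff R * of_nat n * (of_nat j + 1) * of_nat j * (of_nat j - 1)
      * ((of_nat j - 6) * (of_nat n + 1) + 12) = 0"
    using coeff_monom_mult_transvectant4_top[of R "degree R" n] transvectant4_root_poly j
    by (simp add: P)
  then have "of_int ((int j - 6) * (int n + 1) + 12) = (0::'a)"
    using nonzero \<open>R \<noteq> 0\<close> by simp
  moreover have "\<bar>(int j - 6) * (int n + 1) + 12\<bar> < int (n ^ 2)"
    using j n_ge_4 by (intro abs_gap_expression_less) auto
  ultimately show ?thesis by (rule of_int_eq_0D)
qed

lemma binom_gap_relation:
  assumes P: "P = monom 1 n + R" and "R \<noteq> 0" and j: "degree R + j = n" "2 \<le> j"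
  shows "(-1) ^ j * binom j + of_nat (n - 1) * binom 0 = 0"
proof -
  define e :: 'a where "e = (-1) ^ (n - 1)"
  define k where "k = n - 2"
  have k: "n - 1 = Suc k" using n_ge_4 by (simp add: k_def)
  then have "d = n * k + n" by (simp add: d_def)
  then have i: "d - j = n * k + degree R" "0 < d - j" "d - j \<le> N" "N - (d - j) = n - 1 + j"
    using j n_less_d unfolding N_def by linarith+
  have "coeff (P ^ (n - 1)) (d - j) = of_nat (n - 1) * lead_coeff R"
    unfolding P i(1) k by (rule coeff_power_monom_plus) (use j in auto)
  then have "coeff (stepanov_poly A N) (d - j) = e * binom 0 * (of_nat (n - 1) * lead_coeff R)"
    using i(2) by (simp add: stepanov_poly_eq e_def)
  moreover have "lagrange_moment A (n - 1 + j) = - lead_coeff R"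
    using lagrange_moment_beyond_card[OF finite_A, of R j] P j by (simp add: card_A)
  moreover have "of_nat (N choose (d - j)) = binom j"
    using binomial_symmetric[OF i(3)] by (simp only: i(4) binom_def)
  ultimately have "e * binom 0 * (of_nat (n - 1) * lead_coeff R)
      = - (e * (-1) ^ j * binom j * lead_coeff R)"
    using coeff_stepanov_poly[OF i(3), of A] by (simp only: i(4)) (simp add: e_def power_add)
  then have "e * lead_coeff R * ((-1) ^ j * binom j + of_nat (n - 1) * binom 0) = 0"
    by (simp add: algebra_simps)
  then show ?thesis using \<open>R \<noteq> 0\<close> by (simp add: e_def)
qed

lemma exceptional_cases_centred:
  assumes "\<Sum>A = 0"
  shows "n = 5 \<and> of_nat ((24 choose 8) + 4 * (24 choose 4)) = (0::'a) \<or>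
    n = 11 \<and> of_nat ((120 choose 15) - 10 * (120 choose 10)) = (0::'a)"
proof -
  obtain R where R: "P = monom 1 n + R" "R \<noteq> 0" "degree R + 2 \<le> n"
    by (rule root_poly_centredE[OF finite_A _ assms]) (use card_A n_ge_4 in auto)
  define j where "j = n - degree R"
  have j: "degree R + j = n" "2 \<le> j" using R(3) by (auto simp: j_def)
  note top = binom_gap_relation[OF R(1,2) j, unfolded binom_def N_def d_def]
  consider (five) "n = 5" "j = 4" | (eleven) "n = 11" "j = 5"
    using gap_equation_solutions[OF gap_equation[OF R(1,2) j] n_ge_4 j(2)] by blast
  then show ?thesis
  proof cases
    case five
    then have "of_nat ((24 choose 8) + 4 * (24 choose 4)) = (0::'a)" using top by simp
    then show ?thesis using five by blast
  next
    case eleven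
    have "10 * (120 choose 10) \<le> (120 choose 15 :: nat)" by (simp add: choose_120)
    then have "of_nat ((120 choose 15) - 10 * (120 choose 10)) = (0::'a)"
      using top eleven by (simp add: of_nat_diff)
    then show ?thesis using eleven by blast
  qed
qed

lemma exceptional_cases:
  "n = 5 \<and> of_nat ((24 choose 8) + 4 * (24 choose 4)) = (0::'a) \<or>
    n = 11 \<and> of_nat ((120 choose 15) - 10 * (120 choose 10)) = (0::'a)"
proof -
  define c where "c = \<Sum>A / of_nat n"
  interpret T: unit_differences "(\<lambda>x. x - c) ` A" n by (rule unit_differences_translate)
  have "\<Sum>((\<lambda>x. x - c) ` A) = (\<Sum>a\<in>A. a - c)"
    by (subst sum.reindex) (auto simp: inj_on_def)
  also have "\<dots> = 0"
    using linear_factors_nonzero(1) by (simp add: sum_subtractf card_A c_def)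
  finally show ?thesis by (rule T.exceptional_cases_centred)
qed

end

lemma d_critical_uminus_card:
  assumes "d_critical d A (uminus ` A)"
  shows "d = card A * (card A - 1)" "1 < card A"
proof -
  have "card (uminus ` A) = card A" by (rule card_image) simp
  then have "card A * card A = d + card A" using assms by (simp add: d_critical_def)
  then show "d = card A * (card A - 1)" by (simp add: diff_mult_distrib2)
  show "1 < card A" using assms by (simp add: d_critical_def)
qed

lemma d_critical_imp_unit_differences:
  fixes A :: "'p::prime_card mod_ring set"
  assumes crit: "d_critical d A (uminus ` A)" and "d \<notin> {2, 6}" and "2 * d < CARD('p)"
  shows "unit_differences A (card A)"
proof
  note d = d_critical_uminus_card[OF crit]
  have "card A \<noteq> 2" "card A \<noteq> 3" using d(1) assms(2) by auto
  then show n4: "4 \<le> card A" using d(2) by linarith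
  show "(a - b) ^ (card A * (card A - 1)) = 1" if "a \<in> A" "b \<in> A" "a \<noteq> b" for a b
  proof -
    have "a + - b \<in> roots_unity d \<union> {0}"
      using crit that unfolding d_critical_def by blast
    then show ?thesis using that by (simp add: roots_unity_def d(1))
  qed
  have "card A * card A = d + card A" using d(2) by (simp add: d(1) diff_mult_distrib2)
  moreover have "4 * card A \<le> card A * card A" using n4 by simp
  ultimately have small: "(card A)\<^sup>2 < CARD('p)"
    using assms(3) unfolding power2_eq_square by linarith
  show "of_nat k \<noteq> (0::'p mod_ring)" if "0 < k" "k < (card A)\<^sup>2" for k
  proof
    assume "of_nat k = (0::'p mod_ring)"
    then have "CARD('p) \<le> k" using of_nat_0_mod_ring_dvd that(1) by (intro dvd_imp_le)
    then show False using that(2) small by linarith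
  qed
qed auto

lemma proper_dvd_imp_two_mult_le:
  fixes d m :: nat
  assumes "d dvd m" "d < m"
  shows "2 * d \<le> m"
proof -
  obtain q where q: "m = d * q" using assms(1) by (elim dvdE)
  then have "2 \<le> q" using assms(2) by (cases q; cases "q - 1") auto
  then show ?thesis unfolding q by simp
qed

theorem theorem4:
  fixes p d :: nat
  assumes "p = CARD('p::prime_card)"
    and "d dvd p - 1" and "1 < d" and "d < p - 1" and "d \<notin> {2, 6}"
    and "\<not> (p = 41 \<and> d = 20)"
  shows "\<not> (\<exists>A :: 'p mod_ring set. d_critical d A (uminus ` A))"
proof
  assume "\<exists>A :: 'p mod_ring set. d_critical d A (uminus ` A)"
  then obtain A :: "'p mod_ring set" where crit: "d_critical d A (uminus ` A)" ..
  have p: "prime p" using assms(1) prime_card by simp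
  have d_less: "2 * d < p"
    using proper_dvd_imp_two_mult_le[OF assms(2,4)] assms(3) by linarith
  have d: "d = card A * (card A - 1)" by (rule d_critical_uminus_card[OF crit])
  have "unit_differences A (card A)"
    using d_critical_imp_unit_differences[OF crit assms(5)] d_less assms(1) by simp
  from unit_differences.exceptional_cases[OF this]
  consider (five) "card A = 5" "p dvd (24 choose 8) + 4 * (24 choose 4)"
    | (eleven) "card A = 11" "p dvd (120 choose 15) - 10 * (120 choose 10)"
    unfolding assms(1) by (blast dest: of_nat_0_mod_ring_dvd)
  then show False
  proof cases
    case five
    then show False using prime_dvd_choose_24_le[OF p] d_less d assms(6) by force
  next
    case eleven
    then show False using prime_dvd_choose_120_le[OF p] d_less d by force
  qed
qed

end
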